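(* For every $f\in\mathcal{G}_0$, writing $\Psi(f)=f_*\mathrm{Leb}$, $$\mathrm{Ent}(\Psi(f)\,|\,\mathrm{Leb})=-\int_0^1\log f'(x)\,dx .$$
   Context: $\mathrm{Leb}$ is Lebesgue measure on $[0,1]$, and $f_*\mathrm{Leb}$ is the pushforward, $f_*\mathrm{Leb}(A)=\mathrm{Leb}(f^{-1}(A))$. $\mathcal{G}_0$ is the set of right continuous, nondecreasing functions $f:[0,1]\to[0,1]$ with $f(1)=1$ (regarded as elements of $L^2([0,1])$). Such an $f$ is differentiable almost everywhere and $f'$ denotes its almost everywhere defined pointwise derivative; $\log 0=-\infty$, and both sides may take the value $+\infty$. For Borel probability measures $\mu,m$ on a compact metric space $X$, the entropy is $$\mathrm{Ent}(\mu\,|\,m)=\begin{cases}\int_X\rho\log\rho\,dm & \text{if }\mu\ll m\text{ and }\mu=\rho m,\\ +\infty&\text{otherwise.}\end{cases}$$ *)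

theory Defs
  imports "HOL-Analysis.Analysis"
begin

abbreviation Leb :: "real measure" where
  "Leb \<equiv> restrict_space lborel {0..1}"

(* Functions are total on the reals; the values outside [0,1] are left arbitrary and affect
   neither the pushforward of Leb nor the derivative at points of the open interval (0,1).
   An L^2 class is represented by its right continuous member with value 1 at 1. *)
definition G0 :: "(real \<Rightarrow> real) set" where
  "G0 = {f. f \<in> {0..1} \<rightarrow> {0..1} \<and> mono_on {0..1} f \<and>
            (\<forall>x\<in>{0..<1}. continuous (at_right x) f) \<and> f 1 = 1}"

definition Psi :: "(real \<Rightarrow> real) \<Rightarrow> real measure" where
  "Psi f = distr Leb Leb f"

(* Logarithm with log 0 = -\<infinity>; the value at negative arguments is never relevant. *)
definition elog :: "ereal \<Rightarrow> ereal" where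
  "elog x = (if x \<le> 0 then -\<infinity> else if x = \<infinity> then \<infinity> else ereal (ln (real_of_ereal x)))"

(* Lebesgue integral of an extended real function, as the integral of the positive part minus
   that of the negative part. It is meaningful when at least one of the two is finite. The Bochner
   integral is not usable here, since it is 0 for functions that are not integrable. *)
definition ext_integral :: "'a measure \<Rightarrow> ('a \<Rightarrow> ereal) \<Rightarrow> ereal" where
  "ext_integral M g =
     enn2ereal (\<integral>\<^sup>+x. e2ennreal (max 0 (g x)) \<partial>M) -
     enn2ereal (\<integral>\<^sup>+x. e2ennreal (max 0 (- g x)) \<partial>M)"

(* Relative entropy of mu with respect to m, for measures on the same sigma-algebra.
   The density rho is RN_deriv m mu (reference measure first), and 0 * log 0 = 0 * (-\<infinity>) = 0
   by the multiplication of ereal. *)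
definition Ent :: "'a measure \<Rightarrow> 'a measure \<Rightarrow> ereal" where
  "Ent \<mu> m =
     (if absolutely_continuous m \<mu>
      then ext_integral m (\<lambda>x. enn2ereal (RN_deriv m \<mu> x) * elog (enn2ereal (RN_deriv m \<mu> x)))
      else \<infinity>)"

end

theory Submission
  imports Defs
begin

text \<open>
  Let \<open>\<mu> = f\<^sub>* Leb\<close>. If \<open>\<mu> \<ll> Leb\<close> with density \<open>\<rho>\<close>, then \<open>\<mu>\<close> has no atoms, so \<open>f\<close> is injective
  and the distribution function \<open>G\<close> of \<open>\<mu>\<close> satisfies \<open>G (f x) = x\<close>. Lebesgue differentiation gives
  \<open>G' = \<rho>\<close> almost everywhere, also at \<open>f x\<close> for almost every \<open>x\<close>, hence \<open>f' x = 1 / \<rho> (f x)\<close> and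
  \<open>\<integral> \<rho> log \<rho> = \<integral> log \<rho> (f x) dx = - \<integral> log f'\<close>. Applied to \<open>F x = (f x + x) / 2\<close>, whose inverse is
  2-Lipschitz so that \<open>F\<^sub>* Leb \<ll> Leb\<close> always holds, the same argument shows that every monotone \<open>f\<close>
  is differentiable almost everywhere with integrable derivative. If \<open>\<mu>\<close> is not absolutely
  continuous, \<open>f\<close> maps a set of positive measure to a null set; a monotone function expands near any
  point where \<open>f' > 0\<close>, so \<open>f' = 0\<close> almost everywhere on this set and both sides are infinite.
\<close>

section \<open>Lebesgue differentiation on the real line\<close>

text \<open>One-sided half of Lebesgue differentiation, for a single pair of levels; it is applied
  to both \<open>h\<close> and \<open>-h\<close>. The intervals need only contain \<open>y\<close>,
  so \<open>y\<close> may be an endpoint, as difference quotients require.\<close>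

lemma AE_average_upper_bound:
  fixes h :: "real \<Rightarrow> real"
  assumes h: "integrable lborel h" and qq': "q < q'"
  shows "AE y in lborel. h y < q \<longrightarrow> (\<exists>d>0. \<forall>a b. a \<le> y \<and> y \<le> b \<and> a < b \<and> b - a < d \<longrightarrow>
           (LINT x:{a<..b}|lborel. h x) \<le> q' * (b - a))"
proof -
  define good where "good y \<longleftrightarrow> (\<exists>d>0. \<forall>a b. a \<le> y \<and> y \<le> b \<and> a < b \<and> b - a < d \<longrightarrow>
           (LINT x:{a<..b}|lborel. h x) \<le> q' * (b - a))" for y
  define E where "E n = {y. \<bar>y\<bar> < real n \<and> h y < q \<and> \<not> good y}" for n
  have [measurable]: "h \<in> borel_measurable borel"
    using h by auto
  have "negligible (E n)" for n
    unfolding negligible_outer_le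
  proof (intro allI impI)
    fix e :: real
    assume e: "0 < e"
    text \<open>
      The measure with density \<open>(h - q)\<^sup>+\<close> vanishes on \<open>{h < q}\<close>, hence is small on a neighbourhood of it,
      but it charges every interval of length \<open>l\<close> on which the average exceeds \<open>q'\<close> with at least \<open>(q' - q) l\<close>.
      A Vitali covering by such intervals is therefore small.
\<close>
    define J where "J = {- real n<..<real n}"
    define k where "k x = indicator J x * max 0 (h x - q)" for x :: real
    have [measurable]: "J \<in> sets borel" "k \<in> borel_measurable borel"
      unfolding J_def k_def by measurable
    have k0: "0 \<le> k x" for x
      by (auto simp: k_def)
    \<comment> \<open>The bounded window \<open>J\<close> makes the constant \<open>q\<close>
      integrable; it also bounds the radii below, as the Vitali lemma requires.\<close>
    have k: "integrable lborel k"
    proof (rule Bochner_Integration.integrable_bound)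
      show "integrable lborel (\<lambda>x. \<bar>h x\<bar> + indicator J x * \<bar>q\<bar>)"
        using h by (auto simp: J_def)
      show "AE x in lborel. norm (k x) \<le> norm (\<bar>h x\<bar> + indicator J x * \<bar>q\<bar>)"
        by (auto simp: k_def split: split_indicator)
    qed measurable
    define L where "L = density lborel (\<lambda>x. ennreal (k x))"
    have [simp]: "sets L = sets borel" "space L = UNIV"
      by (auto simp: L_def)
    have emL: "emeasure L X = ennreal (LINT x:X|lborel. k x)" if "X \<in> sets borel" for X
    proof -
      have "emeasure L X = (\<integral>\<^sup>+x. ennreal (indicator X x * k x) \<partial>lborel)"
        using that by (auto simp: L_def emeasure_density intro!: nn_integral_cong split: split_indicator)
      also have "\<dots> = ennreal (LINT x|lborel. indicator X x * k x)"
        using that k0 k by (intro nn_integral_eq_integral) (auto intro!: integrable_real_mult_indicator simp: mult.commute)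
      finally show ?thesis
        by (simp add: set_lebesgue_integral_def)
    qed
    interpret L: finite_measure L
      by (rule finite_measureI) (simp add: emL)
    define A where "A = J \<inter> {x. h x < q}"
    have [measurable]: "A \<in> sets borel"
      unfolding A_def by measurable
    have "(LINT x:A|lborel. k x) = 0"
      unfolding set_lebesgue_integral_def
      by (intro Bochner_Integration.integral_eq_zero_AE AE_I2) (auto simp: A_def k_def split: split_indicator)
    \<comment> \<open>The 5 compensates the fivefold enlargement in the Vitali lemma, and
      \<open>q' - q\<close> the ratio between length and \<open>L\<close>-mass in
      \<open>len\<close>.\<close>
    then have "emeasure L A < ennreal ((q' - q) * e / 5)"
      using e qq' by (simp add: emL)
    then obtain U where U: "A \<subseteq> U" "open U" "emeasure L U < ennreal ((q' - q) * e / 5)"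
      using outer_regular[of L A] by (auto simp: INF_less_iff L.emeasure_eq_measure)
    define O' where "O' = U \<inter> J"
    have O': "open O'" "O' \<subseteq> J" "A \<subseteq> O'"
      using U by (auto simp: O'_def A_def J_def)
    have mO': "measure L O' \<le> (q' - q) * e / 5"
    proof -
      have "ennreal (measure L O') \<le> emeasure L U"
        unfolding L.emeasure_eq_measure[symmetric] using U by (intro emeasure_mono) (auto simp: O'_def)
      also have "\<dots> \<le> ennreal ((q' - q) * e / 5)"
        using U by simp
      finally show ?thesis
        using e qq' by (subst (asm) ennreal_le_iff) auto
    qed
    define I where "I = {(a, b). a < b \<and> {a..b} \<subseteq> O' \<and> q' * (b - a) < (LINT x:{a<..b}|lborel. h x)}"
    define c where "c p = (fst p + snd p) / 2" for p :: "real \<times> real"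
    define r where "r p = (snd p - fst p) / 2" for p :: "real \<times> real"
    have cb: "cball (c p) (r p) = {fst p..snd p}" for p
      by (auto simp: c_def r_def cball_eq_atLeastAtMost field_simps)
    \<comment> \<open>If \<open>y\<close> is not good, intervals through \<open>y\<close> with too
      large an average exist at every scale; one that is short enough stays inside the open set
      \<open>O'\<close>.\<close>
    have cov: "E n \<subseteq> (\<Union>p\<in>I. cball (c p) (r p))"
    proof
      fix y assume y: "y \<in> E n"
      then have "y \<in> O'"
        by (intro subsetD[OF O'(3)]) (auto simp: E_def A_def J_def)
      then obtain d where d: "d > 0" "ball y d \<subseteq> O'"
        using O' openE by blast
      obtain a b where ab: "a \<le> y" "y \<le> b" "a < b" "b - a < d" "q' * (b - a) < (LINT x:{a<..b}|lborel. h x)"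
        using y d unfolding E_def good_def by force
      have "{a..b} \<subseteq> O'"
        using ab d by (force simp: dist_real_def)
      then have "(a, b) \<in> I"
        using ab by (auto simp: I_def)
      then show "y \<in> (\<Union>p\<in>I. cball (c p) (r p))"
        using ab unfolding cb by force
    qed
    have rb: "0 < r p \<and> r p \<le> n" if "p \<in> I" for p
    proof -
      have "{fst p..snd p} \<subseteq> {- real n<..<real n}" "fst p < snd p"
        using that O' by (auto simp: I_def J_def)
      moreover from this have "fst p \<in> {- real n<..<real n}" "snd p \<in> {- real n<..<real n}"
        by (meson atLeastAtMost_iff less_imp_le order_refl subsetD)+
      ultimately show ?thesis
        by (auto simp: r_def)
    qed
    obtain C where C: "countable C" "C \<subseteq> I"
      "pairwise (\<lambda>i j. disjnt (cball (c i) (r i)) (cball (c j) (r j))) C"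
      "E n \<subseteq> (\<Union>i\<in>C. cball (c i) (5 * r i))"
      using Vitali_covering_lemma_cballs[OF cov rb] by blast
    have len: "2 * r p * (q' - q) \<le> measure L (cball (c p) (r p))" if "p \<in> I" for p
    proof -
      obtain a b where p: "p = (a, b)" by force
      have ab: "a < b" "{a..b} \<subseteq> J" "q' * (b - a) < (LINT x:{a<..b}|lborel. h x)"
        using that O' by (auto simp: I_def p)
      have hi: "set_integrable lborel {a<..b} h"
        unfolding set_integrable_def using h by (intro integrable_mult_indicator) auto
      have ki: "set_integrable lborel {a<..b} k"
        unfolding set_integrable_def using k by (intro integrable_mult_indicator) auto
      have qi: "set_integrable lborel {a<..b} (\<lambda>x. q)"
        using ab integrable_real_indicator[of "{a<..b}" lborel] by (simp add: set_integrable_def)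
      have J: "x \<in> J" if "x \<in> {a<..b}" for x
        using subsetD[OF ab(2), of x] that by auto
      have "(LINT x:{a<..b}|lborel. h x) - (LINT x:{a<..b}|lborel. q) = (LINT x:{a<..b}|lborel. h x - q)"
        using hi qi by simp
      also have "\<dots> \<le> (LINT x:{a<..b}|lborel. k x)"
        by (intro set_integral_mono set_integral_diff hi qi ki) (auto simp: k_def J)
      also have "\<dots> = measure L {a<..b}"
        using k0 by (simp add: measure_def emL set_lebesgue_integral_def)
      also have "\<dots> \<le> measure L {a..b}"
        by (intro L.finite_measure_mono) auto
      finally show ?thesis
        using ab unfolding cb by (simp add: p r_def set_lebesgue_integral_def algebra_simps)
    qed
    let ?T = "\<Union>i\<in>C. cball (c i) (5 * r i)"
    \<comment> \<open>After multiplication by \<open>q' - q\<close>, lengths are dominated by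
      \<open>L\<close>-masses, and disjointness of the selected balls keeps their sum below the mass
      of \<open>O'\<close>. A uniform bound over finite subfamilies passes to the countable
      union.\<close>
    have bnd: "measure lebesgue (\<Union>i\<in>F. cball (c i) (5 * r i)) \<le> e" if F: "F \<subseteq> C" "finite F" for F
    proof -
      have "measure lebesgue (\<Union>i\<in>F. cball (c i) (5 * r i)) \<le> (\<Sum>i\<in>F. measure lebesgue (cball (c i) (5 * r i)))"
        using F by (intro measure_UNION_le) auto
      also have "\<dots> = (\<Sum>i\<in>F. 10 * r i)"
        using rb F C by (intro sum.cong refl) (force simp: cball_eq_atLeastAtMost)
      also have "(q' - q) * \<dots> = 5 * (\<Sum>i\<in>F. 2 * r i * (q' - q))"
        by (simp add: sum_distrib_left algebra_simps)
      also have "(\<Sum>i\<in>F. 2 * r i * (q' - q)) \<le> (\<Sum>i\<in>F. measure L (cball (c i) (r i)))"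
        using F C by (intro sum_mono len) auto
      also have "\<dots> = measure L (\<Union>i\<in>F. cball (c i) (r i))"
        using F pairwise_subset[OF C(3) F(1)] by (intro L.finite_measure_finite_Union[symmetric])
          (auto simp: disjoint_family_on_def pairwise_def disjnt_def simp del: split_paired_All)
      also have "\<dots> \<le> measure L O'"
      proof (rule L.finite_measure_mono)
        have "cball (c i) (r i) \<subseteq> O'" if "i \<in> I" for i
          using that unfolding cb I_def by auto
        then show "(\<Union>i\<in>F. cball (c i) (r i)) \<subseteq> O'"
          using F(1) C(2) by blast
      qed (use O' in auto)
      also note mO'
      finally show ?thesis
        using qq' by simp
    qed
    show "\<exists>T. E n \<subseteq> T \<and> T \<in> lmeasurable \<and> measure lebesgue T \<le> e"
      using fmeasurable_UN_bound[OF C(1) _ bnd] measure_UN_bound[OF C(1) _ bnd] C(4)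
      by (intro exI[of _ ?T]) auto
  qed
  then have "negligible (\<Union>n. E n)"
    by (intro negligible_countable_Union) auto
  moreover have "{y. \<not> (h y < q \<longrightarrow> good y)} \<subseteq> (\<Union>n. E n)"
    using reals_Archimedean2 by (auto simp: E_def)
  \<comment> \<open>\<open>good\<close> has not been shown measurable, so the null set is found in
    the completion and the statement is then transferred to \<open>lborel\<close>.\<close>
  ultimately have "AE y in lebesgue. h y < q \<longrightarrow> good y"
    by (auto simp: negligible_iff_null_sets intro: AE_I')
  then show ?thesis
    by (simp add: AE_completion_iff good_def)
qed

text \<open>The upper bounds for \<open>h\<close> and \<open>-h\<close> over all rational pairs cost
  only countably many null sets. Off these, averages over intervals shrinking to \<open>y\<close>
  are trapped between \<open>h y - e\<close> and \<open>h y + e\<close>.\<close>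

lemma AE_has_real_derivative_integral:
  fixes h :: "real \<Rightarrow> real"
  assumes h: "integrable lborel h"
  shows "AE y in lborel. ((\<lambda>t. LINT x:{..t}|lborel. h x) has_real_derivative h y) (at y)"
proof -
  define G where "G t = (LINT x:{..t}|lborel. h x)" for t
  have hI: "set_integrable lborel A h" if "A \<in> sets borel" for A
    unfolding set_integrable_def using h that by (intro integrable_mult_indicator) auto
  have G: "(LINT x:{a<..b}|lborel. h x) = G b - G a" if "a < b" for a b
  proof -
    have "{..b} = {..a} \<union> {a<..b}"
      using that by auto
    then have "G b = G a + (LINT x:{a<..b}|lborel. h x)"
      unfolding G_def by (simp only:) (intro set_integral_Un hI; auto)
    then show ?thesis by simp
  qed
  have *: "AE y in lborel. \<forall>q\<in>\<rat>. \<forall>q'\<in>\<rat>. q < q' \<longrightarrow> k y < q \<longrightarrow>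
      (\<exists>d>0. \<forall>a b. a \<le> y \<and> y \<le> b \<and> a < b \<and> b - a < d \<longrightarrow> (LINT x:{a<..b}|lborel. k x) \<le> q' * (b - a))"
    if "integrable lborel k" for k :: "real \<Rightarrow> real"
    using AE_average_upper_bound[OF that]
    by (intro AE_ball_countable' countable_rat AE_impI) auto
  have up: "\<exists>d>0. \<forall>a b. a \<le> y \<and> y \<le> b \<and> a < b \<and> b - a < d \<longrightarrow> (LINT x:{a<..b}|lborel. k x) \<le> (k y + e) * (b - a)"
    if avg: "\<forall>q\<in>\<rat>. \<forall>q'\<in>\<rat>. q < q' \<longrightarrow> k y < q \<longrightarrow>
      (\<exists>d>0. \<forall>a b. a \<le> y \<and> y \<le> b \<and> a < b \<and> b - a < d \<longrightarrow> (LINT x:{a<..b}|lborel. k x) \<le> q' * (b - a))"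
      "e > 0" for k :: "real \<Rightarrow> real" and y e
  proof -
    obtain q' where q': "q' \<in> \<rat>" "k y < q'" "q' < k y + e"
      using Rats_dense_in_real[of "k y" "k y + e"] \<open>e > 0\<close> by auto
    obtain q where q: "q \<in> \<rat>" "k y < q" "q < q'"
      using Rats_dense_in_real q'(2) by blast
    obtain d where d: "d > 0"
      "\<And>a b. a \<le> y \<Longrightarrow> y \<le> b \<Longrightarrow> a < b \<Longrightarrow> b - a < d \<Longrightarrow> (LINT x:{a<..b}|lborel. k x) \<le> q' * (b - a)"
      using avg(1)[rule_format, OF q(1) q'(1) q(3,2)] by blast
    have "q' * (b - a) \<le> (k y + e) * (b - a)" if "a < b" for a b
      using that q' by (intro mult_right_mono) auto
    with d show ?thesis
      by (meson order_trans)
  qed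
  have "integrable lborel (\<lambda>x. - h x)"
    using h by simp
  from *[OF h] *[OF this] show ?thesis
  proof eventually_elim
    case (elim y)
    show ?case
      unfolding has_field_derivative_def has_derivative_at_alt G_def[symmetric]
    proof (intro conjI allI impI bounded_linear_mult_right)
      fix e :: real
      assume e: "e > 0"
      obtain d1 where d1: "d1 > 0"
        "\<And>a b. a \<le> y \<Longrightarrow> y \<le> b \<Longrightarrow> a < b \<Longrightarrow> b - a < d1 \<Longrightarrow> (LINT x:{a<..b}|lborel. h x) \<le> (h y + e) * (b - a)"
        using up[OF elim(1) e] by blast
      obtain d2 where d2: "d2 > 0"
        "\<And>a b. a \<le> y \<Longrightarrow> y \<le> b \<Longrightarrow> a < b \<Longrightarrow> b - a < d2 \<Longrightarrow> (LINT x:{a<..b}|lborel. - h x) \<le> (- h y + e) * (b - a)"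
        using up[OF elim(2) e] by blast
      have key: "\<bar>G b - G a - h y * (b - a)\<bar> \<le> e * (b - a)"
        if "a \<le> y" "y \<le> b" "a < b" "b - a < min d1 d2" for a b
      proof -
        have "(LINT x:{a<..b}|lborel. - h x) = - (G b - G a)"
          using G[OF that(3)] by (simp add: set_lebesgue_integral_def)
        then show ?thesis
          using d1(2)[of a b] d2(2)[of a b] that G[OF that(3)] by (simp add: algebra_simps abs_le_iff)
      qed
      show "\<exists>d>0. \<forall>z. norm (z - y) < d \<longrightarrow> norm (G z - G y - h y * (z - y)) \<le> e * norm (z - y)"
      proof (intro exI[of _ "min d1 d2"] conjI allI impI)
        fix z assume z: "norm (z - y) < min d1 d2"
        consider "z = y" | "y < z" | "z < y" by linarith
        then show "norm (G z - G y - h y * (z - y)) \<le> e * norm (z - y)"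
        proof cases
          case 2
          then show ?thesis using key[of y z] z by auto
        next
          case 3
          have "\<bar>G z - G y - h y * (z - y)\<bar> = \<bar>G y - G z - h y * (y - z)\<bar>"
            by (simp add: algebra_simps abs_minus_commute)
          then show ?thesis using key[of z y] 3 z by auto
        qed auto
      qed (use d1 d2 in auto)
    qed
  qed
qed

section \<open>Monotone functions and push-forwards of Lebesgue measure\<close>

text \<open>The inverse map on the image of \<open>A\<close> has a Lipschitz bound anchored at each
  point, with a constant depending on that point; such maps send null sets to null sets.\<close>

lemma negligible_if_negligible_expanding_image:
  fixes f :: "'a::euclidean_space \<Rightarrow> 'a"
  assumes neg: "negligible (f ` A)"
    and exp: "\<And>x. x \<in> A \<Longrightarrow> \<exists>c>0. \<forall>z\<in>A. c * norm (z - x) \<le> norm (f z - f x)"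
  shows "negligible A"
proof -
  have inj: "inj_on f A"
  proof (rule inj_onI)
    fix x y assume xy: "x \<in> A" "y \<in> A" "f x = f y"
    then obtain c where "c > 0" "c * norm (y - x) \<le> norm (f y - f x)"
      using exp by blast
    with xy show "x = y"
      by (simp add: mult_le_0_iff)
  qed
  let ?k = "the_inv_into A f"
  have "negligible (?k ` (f ` A))"
  proof (rule negligible_locally_Lipschitz_image[OF order_refl neg])
    fix y assume "y \<in> f ` A"
    then obtain x where x: "x \<in> A" "y = f x" by blast
    obtain c where c: "c > 0" "\<And>z. z \<in> A \<Longrightarrow> c * norm (z - x) \<le> norm (f z - f x)"
      using exp[OF x(1)] by blast
    have "norm (?k w - ?k y) \<le> inverse c * norm (w - y)" if "w \<in> f ` A" for w
      using c x inj that by (auto simp: the_inv_into_f_f field_simps)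
    then show "\<exists>T B. open T \<and> y \<in> T \<and> (\<forall>w\<in>f ` A \<inter> T. norm (?k w - ?k y) \<le> B * norm (w - y))"
      by (intro exI[of _ UNIV] exI[of _ "inverse c"]) auto
  qed
  also have "?k ` (f ` A) = A"
    using inj by (simp add: image_image the_inv_into_f_f cong: image_cong_simp)
  finally show ?thesis .
qed

section \<open>Null sets and absolute continuity on the unit interval\<close>

lemma finite_measure_Leb: "finite_measure Leb"
  by (rule finite_measureI) (simp add: emeasure_restrict_space space_restrict_space)

lemma AE_Leb_iff: "(AE x in Leb. P x) \<longleftrightarrow> (AE x in lborel. x \<in> {0..1} \<longrightarrow> P x)"
  by (rule AE_restrict_space_iff) auto

text \<open>\<open>negligible\<close> refers to the completed measure and \<open>Leb\<close> to
  Borel sets. They agree here because an almost everywhere statement only asks for a null superset,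
  so \<open>P\<close> may be nonmeasurable.\<close>

lemma AE_Leb_iff_negligible:
  "(AE x in Leb. P x) \<longleftrightarrow> negligible {x \<in> {0..1}. \<not> P x}"
proof -
  have "{x. \<not> (x \<in> {0..1} \<longrightarrow> P x)} = {x \<in> {0..1}. \<not> P x}"
    by auto
  then show ?thesis
    unfolding AE_Leb_iff AE_completion_iff[where M=lborel, symmetric] eventually_ae_filter_negligible
    using negligible_subset by blast
qed

lemma measurable_mono_Leb:
  fixes f :: "real \<Rightarrow> real"
  assumes "f \<in> {0..1} \<rightarrow> {0..1}" "mono_on {0..1} f"
  shows "f \<in> measurable Leb Leb"
proof (rule measurable_restrict_space2)
  have "f \<in> borel_measurable (restrict_space borel {0..1})"
    using assms by (intro borel_measurable_mono_on_fnc)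
  moreover have "sets Leb = sets (restrict_space borel {0..1})"
    by (intro sets_restrict_space_cong) simp
  ultimately show "f \<in> measurable Leb lborel"
    using measurable_cong_sets[of Leb _ lborel borel] by simp
qed (use assms in \<open>auto simp: space_restrict_space\<close>)

text \<open>Brings absolute continuity into the language of \<open>negligible\<close>, where the
  lemma on expanding maps applies.\<close>

lemma absolutely_continuous_distr_Leb_iff:
  assumes f: "f \<in> measurable Leb Leb"
  shows "absolutely_continuous Leb (distr Leb Leb f) \<longleftrightarrow>
    (\<forall>X\<in>sets borel. X \<subseteq> {0..1} \<and> negligible X \<longrightarrow> negligible {x\<in>{0..1}. f x \<in> X})"
proof -
  have null: "X \<in> null_sets Leb \<longleftrightarrow> X \<in> sets borel \<and> X \<subseteq> {0..1} \<and> negligible X" for X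
    by (auto simp: null_sets_restrict_space negligible_iff_null_sets null_sets_completion_iff
        intro: null_sets_completionI)
  have "X \<in> null_sets (distr Leb Leb f) \<longleftrightarrow> negligible {x\<in>{0..1}. f x \<in> X}" if "X \<in> null_sets Leb" for X
  proof -
    have X: "X \<in> sets Leb" using that by auto
    have eq: "f -` X \<inter> space Leb = {x\<in>{0..1}. f x \<in> X}"
      by (auto simp: space_restrict_space)
    have m: "{x\<in>{0..1}. f x \<in> X} \<in> sets borel"
      using measurable_sets[OF f X] unfolding eq by (simp add: sets_restrict_space_iff)
    have "X \<in> null_sets (distr Leb Leb f) \<longleftrightarrow> {x\<in>{0..1}. f x \<in> X} \<in> null_sets Leb"
      unfolding eq[symmetric] null_sets_distr_iff[OF f] using X by simp
    also have "\<dots> \<longleftrightarrow> negligible {x\<in>{0..1}. f x \<in> X}"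
      using m by (auto simp: null)
    finally show ?thesis .
  qed
  then have "absolutely_continuous Leb (distr Leb Leb f) \<longleftrightarrow>
    (\<forall>X\<in>null_sets Leb. negligible {x\<in>{0..1}. f x \<in> X})"
    unfolding absolutely_continuous_def by blast
  then show ?thesis
    by (simp only: null Ball_def conj_assoc imp_conjL)
qed

section \<open>The derivative as the reciprocal of the push-forward density\<close>

text \<open>The inverse function rule needs three facts at almost every \<open>x\<close>.
  Differentiability of \<open>G\<close> at \<open>f x\<close> transfers along \<open>f\<close> by
  absolute continuity; the density is positive there because a measure does not charge the zero set
  of its density; \<open>f\<close> is continuous at \<open>x\<close> because a monotone function has
  only countably many discontinuities.\<close>

lemma AE_derivative_eq_inverse_density:
  fixes f :: "real \<Rightarrow> real"
  assumes f01: "f \<in> {0..1} \<rightarrow> {0..1}" and mono: "mono_on {0..1} f"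
    and ac: "absolutely_continuous Leb (distr Leb Leb f)"
  defines "\<rho> \<equiv> RN_deriv Leb (distr Leb Leb f)"
  shows "AE x in Leb. 0 < enn2real (\<rho> (f x)) \<and> \<rho> (f x) \<noteq> \<infinity> \<and>
           (f has_real_derivative inverse (enn2real (\<rho> (f x)))) (at x)"
proof -
  interpret Leb: finite_measure Leb
    by (rule finite_measure_Leb)
  have f[measurable]: "f \<in> measurable Leb Leb"
    by (rule measurable_mono_Leb[OF f01 mono])
  have [measurable]: "\<rho> \<in> borel_measurable Leb"
    unfolding \<rho>_def by (rule borel_measurable_RN_deriv)
  let ?\<mu> = "distr Leb Leb f"
  interpret \<mu>: finite_measure ?\<mu>
    by (rule Leb.finite_measure_distr[OF f])
  have dens: "density Leb \<rho> = ?\<mu>"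
    unfolding \<rho>_def by (rule Leb.density_RN_deriv[OF ac]) simp
  have fin: "AE y in Leb. \<rho> y \<noteq> \<infinity>"
    unfolding \<rho>_def by (rule Leb.RN_deriv_finite[OF _ ac]) (simp_all add: \<mu>.sigma_finite_measure_axioms)
  have push: "AE x in Leb. P (f x)" if "AE y in Leb. P y" for P
    using absolutely_continuous_AE[OF _ ac that] by (intro AE_distrD[OF f]) simp
  have "AE y in ?\<mu>. 0 < \<rho> y"
    unfolding dens[symmetric] by (simp add: AE_density)
  then have pos: "AE x in Leb. 0 < \<rho> (f x)"
    by (rule AE_distrD[OF f])
  \<comment> \<open>A real-valued version on the whole line, as the differentiation theorem demands;
    \<open>enn2real\<close> changes \<open>\<rho>\<close> only on the null set where it is
    infinite.\<close>
  define r where "r y = (if y \<in> {0..1} then enn2real (\<rho> y) else 0)" for y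
  have r0: "0 \<le> r y" for y
    by (simp add: r_def)
  have r[measurable]: "r \<in> borel_measurable borel"
  proof -
    have "(\<lambda>y. enn2real (\<rho> y)) \<in> borel_measurable Leb"
      by measurable
    then have "r \<in> borel_measurable lborel"
      unfolding r_def by (subst (asm) measurable_restrict_space_iff) auto
    then show ?thesis by simp
  qed
  \<comment> \<open>Used with \<open>X = UNIV\<close> for integrability, with a singleton for the
    absence of atoms, and with a half-line to compute \<open>G\<close>.\<close>
  have int_r: "(\<integral>\<^sup>+y. ennreal (r y) * indicator X y \<partial>lborel) = emeasure lborel {x\<in>{0..1}. f x \<in> X}"
    if X: "X \<in> sets borel" for X
  proof -
    let ?Y = "X \<inter> {0..1}"
    have Y: "?Y \<in> sets Leb"
      using X by (auto simp: sets_restrict_space_iff)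
    have "AE y in Leb. \<rho> y * indicator ?Y y = ennreal (r y) * indicator ?Y y"
      using fin by (auto simp: r_def less_top split: split_indicator)
    then have "emeasure ?\<mu> ?Y = (\<integral>\<^sup>+y. ennreal (r y) * indicator ?Y y \<partial>Leb)"
      using Y unfolding dens[symmetric] by (simp add: emeasure_density nn_integral_cong_AE)
    also have "\<dots> = (\<integral>\<^sup>+y. ennreal (r y) * indicator X y \<partial>lborel)"
      by (subst nn_integral_restrict_space) (auto intro!: nn_integral_cong simp: r_def split: split_indicator)
    finally have "(\<integral>\<^sup>+y. ennreal (r y) * indicator X y \<partial>lborel) = emeasure Leb (f -` ?Y \<inter> space Leb)"
      using Y by (simp add: emeasure_distr)
    also have "f -` ?Y \<inter> space Leb = {x\<in>{0..1}. f x \<in> X}"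
      using f01 by (auto simp: space_restrict_space)
    finally show ?thesis
      by (subst (asm) emeasure_restrict_space) auto
  qed
  have "integrable lborel r"
  proof (rule integrableI_nonneg)
    have "(\<integral>\<^sup>+y. ennreal (r y) \<partial>lborel) = emeasure lborel {x\<in>{0..1}. f x \<in> UNIV}"
      using int_r[of UNIV] by simp
    also have "{x\<in>{0..1}. f x \<in> UNIV} = {0..1}"
      by auto
    finally show "(\<integral>\<^sup>+y. ennreal (r y) \<partial>lborel) < \<infinity>"
      by simp
  qed (use r0 in auto)
  define G where "G t = (LINT y:{..t}|lborel. r y)" for t
  have G_deriv: "AE y in Leb. (G has_real_derivative r y) (at y)"
    unfolding AE_Leb_iff G_def using AE_has_real_derivative_integral[OF \<open>integrable lborel r\<close>] by auto
  have Gf: "G (f x) = x" if x: "x \<in> {0..1}" for x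
  proof -
    have "{f x} \<in> null_sets Leb"
      using f01 x by (auto simp: null_sets_restrict_space)
    then have "(\<integral>\<^sup>+y. ennreal (r y) * indicator {f x} y \<partial>lborel) = 0"
      by (simp add: nn_integral_cong_AE)
    then have level: "emeasure lborel {z\<in>{0..1}. f z \<in> {f x}} = 0"
      by (subst (asm) int_r) auto
    have msr: "{z\<in>{0..1}. f z \<in> X} \<in> sets lborel" if "X \<in> sets borel" for X
    proof -
      have "X \<inter> {0..1} \<in> sets Leb"
        using that by (auto simp: sets_restrict_space_iff)
      from measurable_sets[OF f this] have "f -` (X \<inter> {0..1}) \<inter> space Leb \<in> sets borel"
        by (simp add: sets_restrict_space_iff)
      also have "f -` (X \<inter> {0..1}) \<inter> space Leb = {z\<in>{0..1}. f z \<in> X}"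
        using f01 by (auto simp: space_restrict_space)
      finally show ?thesis by simp
    qed
    have null: "{z\<in>{0..1}. f z \<in> {f x}} \<in> null_sets lborel"
      using level msr[of "{f x}"] by (intro null_setsI) auto
    \<comment> \<open>By monotonicity, a point right of \<open>x\<close> with value at most
      \<open>f x\<close> lies in the level set of \<open>f x\<close>, which is null.\<close>
    have "{z\<in>{0..1}. f z \<in> {..f x}} = {0..x} \<union> {z\<in>{0..1}. f z \<in> {f x}}"
    proof (intro equalityI subsetI)
      fix z assume z: "z \<in> {z\<in>{0..1}. f z \<in> {..f x}}"
      show "z \<in> {0..x} \<union> {z\<in>{0..1}. f z \<in> {f x}}"
        using z x monotone_onD[OF mono, of x z] by (cases "z \<le> x") auto
    next
      fix z assume "z \<in> {0..x} \<union> {z\<in>{0..1}. f z \<in> {f x}}"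
      then show "z \<in> {z\<in>{0..1}. f z \<in> {..f x}}"
        using x monotone_onD[OF mono, of z x] by auto
    qed
    then have "emeasure lborel {z\<in>{0..1}. f z \<in> {..f x}} = ennreal x"
      using x null by (simp add: emeasure_Un_null_set)
    moreover have "ennreal (indicator {..f x} y * r y) = ennreal (r y) * indicator {..f x} y" for y
      by (simp split: split_indicator)
    ultimately have "(\<integral>\<^sup>+y. ennreal (indicator {..f x} y * r y) \<partial>lborel) = ennreal x"
      using int_r[of "{..f x}"] by simp
    then show ?thesis
      unfolding G_def set_lebesgue_integral_def using x r0
      by (subst integral_eq_nn_integral) auto
  qed
  have "countable {x\<in>{0<..<1}. \<not> isCont f x}"
    by (rule mono_on_ctble_discont_open) (auto intro: monotone_on_subset[OF mono])
  \<comment> \<open>The endpoints are discarded as well: \<open>f\<close> is arbitrary outside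
    \<open>{0..1}\<close>, so only interior points are under control.\<close>
  then have "countable ({x\<in>{0<..<1}. \<not> isCont f x} \<union> {0, 1})"
    by simp
  then have "AE x in lborel. x \<notin> {x\<in>{0<..<1}. \<not> isCont f x} \<union> {0, 1}"
    by (intro AE_not_in countable_imp_null_set_lborel)
  then have cont: "AE x in Leb. x \<in> {0<..<1} \<and> isCont f x"
    unfolding AE_Leb_iff by eventually_elim auto
  from push[OF G_deriv] push[OF fin] pos cont show ?thesis
  proof eventually_elim
    case (elim x)
    then have rx: "r (f x) = enn2real (\<rho> (f x))"
      using f01 by (force simp: r_def)
    have "0 < r (f x)"
      using elim unfolding rx by (simp add: enn2real_positive_iff less_top)
    \<comment> \<open>Here \<open>f\<close> plays the inverse and \<open>G\<close> the given map;
      \<open>Gf\<close> holds throughout the open interval, which serves as the neighbourhood of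
      \<open>x\<close> in the rule.\<close>
    moreover have "(f has_real_derivative inverse (r (f x))) (at x)"
      using elim \<open>0 < r (f x)\<close> Gf
      by (intro has_field_derivative_inverse_basic[where f = G and g = f and y = x and t = "{0<..<1}"]) auto
    ultimately show ?case
      using elim unfolding rx by simp
  qed
qed

section \<open>Almost everywhere differentiability of monotone functions\<close>

text \<open>Differentiability passes from \<open>F\<close> to \<open>f\<close> through
  \<open>f x = 2 * F x - x\<close>. For the integral, \<open>deriv f\<close> is at most twice the
  reciprocal of \<open>\<rho> (F x)\<close>, and changing variables turns the integral of that
  reciprocal into one of \<open>\<rho>\<close> times its own reciprocal, at most 1.\<close>

lemma mono_on_AE_differentiable_and_deriv_integral:
  fixes f :: "real \<Rightarrow> real"
  assumes f01: "f \<in> {0..1} \<rightarrow> {0..1}" and mono: "mono_on {0..1} f"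
  shows mono_on_AE_differentiable: "AE x in Leb. f differentiable (at x)"
    and nn_integral_deriv_mono_on_finite: "(\<integral>\<^sup>+x. ennreal (deriv f x) \<partial>Leb) < \<infinity>"
proof -
  \<comment> \<open>The summand \<open>x\<close> makes \<open>F\<close> expand distances by at least
    1/2; the halving keeps its values in \<open>{0..1}\<close>.\<close>
  define F where "F x = (f x + x) / 2" for x
  have F01: "F \<in> {0..1} \<rightarrow> {0..1}"
  proof
    fix x :: real
    assume "x \<in> {0..1}"
    then show "F x \<in> {0..1}"
      using funcset_mem[OF f01, of x] by (simp add: F_def)
  qed
  have fle: "f x \<le> f y" if "x \<in> {0..1}" "y \<in> {0..1}" "x \<le> y" for x y
    using monotone_onD[OF mono] that by auto
  have Fmono: "mono_on {0..1} F"
    by (intro monotone_onI) (use fle in \<open>auto simp: F_def add_mono\<close>)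
  have F[measurable]: "F \<in> measurable Leb Leb"
    by (rule measurable_mono_Leb[OF F01 Fmono])
  have exp: "1 / 2 * norm (z - x) \<le> norm (F z - F x)" if "x \<in> {0..1}" "z \<in> {0..1}" for x z
    using fle[of x z] fle[of z x] that by (cases "x \<le> z") (auto simp: F_def field_simps)
  have ac: "absolutely_continuous Leb (distr Leb Leb F)"
    unfolding absolutely_continuous_distr_Leb_iff[OF F]
  proof (intro ballI impI)
    fix X :: "real set"
    assume X: "X \<subseteq> {0..1} \<and> negligible X"
    show "negligible {x\<in>{0..1}. F x \<in> X}"
    proof (rule negligible_if_negligible_expanding_image[of F])
      show "negligible (F ` {x\<in>{0..1}. F x \<in> X})"
        by (rule negligible_subset[of X]) (use X in auto)
    qed (use exp in \<open>auto intro!: exI[of _ "1/2"]\<close>)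
  qed
  define \<rho> where "\<rho> = RN_deriv Leb (distr Leb Leb F)"
  have [measurable]: "\<rho> \<in> borel_measurable Leb"
    unfolding \<rho>_def by (rule borel_measurable_RN_deriv)
  have AE: "AE x in Leb. 0 < enn2real (\<rho> (F x)) \<and> \<rho> (F x) \<noteq> \<infinity> \<and>
           (F has_real_derivative inverse (enn2real (\<rho> (F x)))) (at x)"
    unfolding \<rho>_def by (rule AE_derivative_eq_inverse_density[OF F01 Fmono ac])
  have fF: "f = (\<lambda>x. 2 * F x - x)"
    by (auto simp: F_def add_divide_distrib)
  have deriv_f: "(f has_real_derivative 2 * D - 1) (at x)" if "(F has_real_derivative D) (at x)" for x D
    unfolding fF by (auto intro!: derivative_eq_intros that)
  show "AE x in Leb. f differentiable (at x)"
    using AE by eventually_elim (meson deriv_f real_differentiable_def)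
  interpret Leb: finite_measure Leb
    by (rule finite_measure_Leb)
  have dens: "density Leb \<rho> = distr Leb Leb F"
    unfolding \<rho>_def by (rule Leb.density_RN_deriv[OF ac]) simp
  have "(\<integral>\<^sup>+x. ennreal (deriv f x) \<partial>Leb) \<le> (\<integral>\<^sup>+x. 2 * ennreal (inverse (enn2real (\<rho> (F x)))) \<partial>Leb)"
  proof (rule nn_integral_mono_AE)
    show "AE x in Leb. ennreal (deriv f x) \<le> 2 * ennreal (inverse (enn2real (\<rho> (F x))))"
      using AE
    proof eventually_elim
      case (elim x)
      then have "deriv f x = 2 * inverse (enn2real (\<rho> (F x))) - 1"
        by (intro DERIV_imp_deriv deriv_f) simp
      then have "deriv f x \<le> 2 * inverse (enn2real (\<rho> (F x)))"
        by simp
      then have "ennreal (deriv f x) \<le> ennreal (2 * inverse (enn2real (\<rho> (F x))))"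
        by (rule ennreal_leI)
      then show ?case
        by (simp add: ennreal_mult)
    qed
  qed
  also have "\<dots> = 2 * (\<integral>\<^sup>+x. ennreal (inverse (enn2real (\<rho> (F x)))) \<partial>Leb)"
    by (rule nn_integral_cmult) measurable
  also have "(\<integral>\<^sup>+x. ennreal (inverse (enn2real (\<rho> (F x)))) \<partial>Leb)
      = (\<integral>\<^sup>+y. ennreal (inverse (enn2real (\<rho> y))) \<partial>distr Leb Leb F)"
    by (rule nn_integral_distr[symmetric]) measurable
  also have "\<dots> = (\<integral>\<^sup>+y. \<rho> y * ennreal (inverse (enn2real (\<rho> y))) \<partial>Leb)"
    unfolding dens[symmetric] by (rule nn_integral_density) measurable
  finally have *: "(\<integral>\<^sup>+x. ennreal (deriv f x) \<partial>Leb)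
      \<le> 2 * (\<integral>\<^sup>+y. \<rho> y * ennreal (inverse (enn2real (\<rho> y))) \<partial>Leb)" .
  \<comment> \<open>Where \<open>\<rho> y\<close> is 0 or infinite the product is 0:
    \<open>enn2real\<close> sends infinity to 0, and \<open>inverse 0 = 0\<close>.\<close>
  have "(\<integral>\<^sup>+y. \<rho> y * ennreal (inverse (enn2real (\<rho> y))) \<partial>Leb) \<le> (\<integral>\<^sup>+y. 1 \<partial>Leb)"
  proof (rule nn_integral_mono)
    fix y
    show "\<rho> y * ennreal (inverse (enn2real (\<rho> y))) \<le> 1"
    proof (cases "\<rho> y")
      case (real s)
      then show ?thesis
        by (cases "s = 0") (auto simp: ennreal_mult[symmetric] simp flip: ennreal_1)
    qed simp
  qed
  also have "(\<integral>\<^sup>+y. 1 \<partial>Leb) = 1"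
    by (simp add: emeasure_restrict_space space_restrict_space)
  finally have "2 * (\<integral>\<^sup>+y. \<rho> y * ennreal (inverse (enn2real (\<rho> y))) \<partial>Leb) \<le> 2 * 1"
    by (rule mult_left_mono) simp
  with * have "(\<integral>\<^sup>+x. ennreal (deriv f x) \<partial>Leb) \<le> 2 * 1"
    by (rule order_trans)
  also have "\<dots> < (\<infinity>::ennreal)"
    by (simp add: less_top[symmetric])
  finally show "(\<integral>\<^sup>+x. ennreal (deriv f x) \<partial>Leb) < \<infinity>" .
qed

text \<open>Near \<open>x\<close> the derivative gives slope at least \<open>D / 2\<close>. Farther
  away monotonicity preserves the increment already gained at distance \<open>d / 2\<close>, while
  distances in \<open>{0..1}\<close> never exceed 1.\<close>

lemma mono_on_expanding_at_deriv_pos: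
  fixes f :: "real \<Rightarrow> real"
  assumes mono: "mono_on {0..1} f" and x: "x \<in> {0..1}"
    and D: "(f has_real_derivative D) (at x)" "0 < D"
  shows "\<exists>c>0. \<forall>z\<in>{0..1}. c * norm (z - x) \<le> norm (f z - f x)"
proof -
  obtain d where d: "d > 0"
    "\<And>z. \<bar>z - x\<bar> < d \<Longrightarrow> \<bar>f z - f x - D * (z - x)\<bar> \<le> D / 2 * \<bar>z - x\<bar>"
    using D unfolding has_field_derivative_def has_derivative_at_alt real_norm_def by (metis half_gt_zero)
  have near: "D / 2 * \<bar>z - x\<bar> \<le> \<bar>f z - f x\<bar>" if "\<bar>z - x\<bar> < d" for z
  proof -
    have "D * \<bar>z - x\<bar> = \<bar>D * (z - x)\<bar>"
      using D by (simp add: abs_mult)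
    also have "\<dots> \<le> \<bar>f z - f x\<bar> + D / 2 * \<bar>z - x\<bar>"
      using d(2)[OF that] by linarith
    finally show ?thesis by simp
  qed
  have fle: "f u \<le> f v" if "u \<in> {0..1}" "v \<in> {0..1}" "u \<le> v" for u v
    using monotone_onD[OF mono] that by auto
  \<comment> \<open>\<open>D * d / 4\<close> is the increment guaranteed by slope
    \<open>D / 2\<close> over the distance \<open>d / 2\<close>.\<close>
  define c where "c = min (D / 2) (D * d / 4)"
  have c: "c > 0" "c \<le> D / 2" "c \<le> D * d / 4"
    using D d by (auto simp: c_def)
  have "c * \<bar>z - x\<bar> \<le> \<bar>f z - f x\<bar>" if z: "z \<in> {0..1}" for z
  proof (cases "\<bar>z - x\<bar> < d")
    case True
    have "c * \<bar>z - x\<bar> \<le> D / 2 * \<bar>z - x\<bar>"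
      using c by (intro mult_right_mono) auto
    with near[OF True] show ?thesis by linarith
  next
    case False
    have "c * \<bar>z - x\<bar> \<le> D * d / 4 * 1"
      using c x z D d by (intro mult_mono) auto
    also have "\<dots> \<le> \<bar>f z - f x\<bar>"
    proof (cases "x \<le> z")
      case True
      then have "f x \<le> f (x + d / 2)" "f (x + d / 2) \<le> f z"
        using False x z d by (auto intro!: fle)
      with near[of "x + d / 2"] d show ?thesis by simp
    next
      case xz: False
      then have "f (x - d / 2) \<le> f x" "f z \<le> f (x - d / 2)"
        using False x z d by (auto intro!: fle)
      with near[of "x - d / 2"] d show ?thesis by simp
    qed
    finally show ?thesis .
  qed
  with c show ?thesis by auto
qed

section \<open>Entropy\<close>

lemma measurable_elog[measurable]: "elog \<in> borel_measurable borel"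
  unfolding elog_def by measurable

lemma elog_inverse: "0 < s \<Longrightarrow> elog (ereal (inverse s)) = - elog (ereal s)"
  by (simp add: elog_def ln_inverse)

lemma elog_le: "elog (ereal s) \<le> ereal s"
proof (cases "s \<le> 0")
  case False
  then show ?thesis
    using ln_le_minus_one[of s] by (auto simp: elog_def)
qed (simp add: elog_def)

lemma e2ennreal_max_0: "e2ennreal (max 0 a) = e2ennreal a"
  by (simp add: e2ennreal_def)

lemma e2ennreal_mult_ereal:
  assumes "0 < t"
  shows "e2ennreal (ereal t * a) = ennreal t * e2ennreal a"
  using assms by (cases a) (simp_all add: ennreal_mult' e2ennreal_neg ennreal_mult_top)

text \<open>Splits the factor \<open>t\<close> off the positive and negative parts, so that the
  entropy integrand becomes \<open>\<rho>\<close> times a function of \<open>\<rho>\<close>. At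
  \<open>t = 0\<close> both sides vanish, since zero times infinity is 0 in \<open>ereal\<close> and
  in \<open>ennreal\<close>.\<close>

lemma e2ennreal_mult_elog:
  assumes "0 \<le> t"
  shows "e2ennreal (max 0 (ereal t * elog (ereal t))) = ennreal t * e2ennreal (max 0 (elog (ereal t)))"
    and "e2ennreal (max 0 (- (ereal t * elog (ereal t)))) = ennreal t * e2ennreal (max 0 (- elog (ereal t)))"
proof -
  have "e2ennreal (ereal t * elog (ereal t)) = ennreal t * e2ennreal (elog (ereal t)) \<and>
    e2ennreal (- (ereal t * elog (ereal t))) = ennreal t * e2ennreal (- elog (ereal t))"
  proof (cases "t = 0")
    case True
    then show ?thesis
      by (simp add: zero_ereal_def[symmetric] e2ennreal_neg)
  next
    case False
    then have "0 < t" using assms by simp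
    then show ?thesis
      using e2ennreal_mult_ereal[of t "elog (ereal t)"] e2ennreal_mult_ereal[of t "- elog (ereal t)"]
      by (simp only: ereal_mult_minus_right simp_thms)
  qed
  then show "e2ennreal (max 0 (ereal t * elog (ereal t))) = ennreal t * e2ennreal (max 0 (elog (ereal t)))"
    "e2ennreal (max 0 (- (ereal t * elog (ereal t)))) = ennreal t * e2ennreal (max 0 (- elog (ereal t)))"
    by (simp_all only: e2ennreal_max_0 simp_thms)
qed

section \<open>Integrals of the logarithmic derivative\<close>

text \<open>Since \<open>log s \<le> s\<close>, the positive part is dominated by the derivative,
  whose integral is finite. This excludes an infinite positive part in the final formula.\<close>

lemma nn_integral_elog_deriv_finite:
  fixes f :: "real \<Rightarrow> real"
  assumes "f \<in> {0..1} \<rightarrow> {0..1}" "mono_on {0..1} f"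
  shows "(\<integral>\<^sup>+x. e2ennreal (max 0 (elog (ereal (deriv f x)))) \<partial>Leb) < \<infinity>"
proof -
  have "e2ennreal (max 0 (elog (ereal s))) \<le> ennreal s" for s
    using e2ennreal_mono[OF elog_le[of s]] by (simp add: e2ennreal_max_0)
  then have "(\<integral>\<^sup>+x. e2ennreal (max 0 (elog (ereal (deriv f x)))) \<partial>Leb) \<le> (\<integral>\<^sup>+x. ennreal (deriv f x) \<partial>Leb)"
    by (intro nn_integral_mono)
  also have "\<dots> < \<infinity>"
    by (rule nn_integral_deriv_mono_on_finite[OF assms])
  finally show ?thesis .
qed

lemma nn_integral_neg_elog_deriv_singular:
  fixes f :: "real \<Rightarrow> real"
  assumes f01: "f \<in> {0..1} \<rightarrow> {0..1}" and mono: "mono_on {0..1} f"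
    and not_ac: "\<not> absolutely_continuous Leb (distr Leb Leb f)"
  shows "(\<integral>\<^sup>+x. e2ennreal (max 0 (- elog (ereal (deriv f x)))) \<partial>Leb) = \<infinity>"
proof -
  have f: "f \<in> measurable Leb Leb"
    by (rule measurable_mono_Leb[OF f01 mono])
  obtain X where X: "X \<in> sets borel" "X \<subseteq> {0..1}" "negligible X" "\<not> negligible {x\<in>{0..1}. f x \<in> X}"
    using not_ac unfolding absolutely_continuous_distr_Leb_iff[OF f] by blast
  define A where "A = {x\<in>{0..1}. f x \<in> X}"
  have "X \<in> sets Leb"
    using X by (auto simp: sets_restrict_space_iff)
  from measurable_sets[OF f this] have A: "A \<in> sets Leb"
    by (simp add: A_def vimage_def Int_def space_restrict_space conj_commute)
  \<comment> \<open>\<open>f\<close> sends \<open>?B\<close> into the null set \<open>X\<close>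
    while expanding at each of its points.\<close>
  have "negligible {x\<in>A. f differentiable (at x) \<and> 0 < deriv f x}" (is "negligible ?B")
  proof (rule negligible_if_negligible_expanding_image)
    show "negligible (f ` ?B)"
      by (rule negligible_subset[OF X(3)]) (auto simp: A_def)
    fix x assume x: "x \<in> ?B"
    then have "(f has_real_derivative deriv f x) (at x)"
      by (simp add: DERIV_deriv_iff_real_differentiable)
    then obtain c where "c > 0" "\<forall>z\<in>{0..1}. c * norm (z - x) \<le> norm (f z - f x)"
      using mono_on_expanding_at_deriv_pos[OF mono, of x "deriv f x"] x by (auto simp: A_def)
    then show "\<exists>c>0. \<forall>z\<in>?B. c * norm (z - x) \<le> norm (f z - f x)"
      by (auto simp: A_def)
  qed
  then have "AE x in Leb. x \<notin> ?B"
    unfolding AE_Leb_iff_negligible by (rule negligible_subset) auto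
  \<comment> \<open>At the remaining points of \<open>A\<close> the derivative is at most 0, where
    \<open>elog\<close> is \<open>-\<infinity>\<close>.\<close>
  with mono_on_AE_differentiable[OF f01 mono]
  have "AE x in Leb. \<infinity> * indicator A x \<le> e2ennreal (max 0 (- elog (ereal (deriv f x))))"
    by eventually_elim (auto simp: elog_def max_def split: split_indicator)
  then have "(\<integral>\<^sup>+x. \<infinity> * indicator A x \<partial>Leb) \<le> (\<integral>\<^sup>+x. e2ennreal (max 0 (- elog (ereal (deriv f x)))) \<partial>Leb)"
    by (rule nn_integral_mono_AE)
  moreover have "(\<integral>\<^sup>+x. \<infinity> * indicator A x \<partial>Leb) = \<infinity> * emeasure Leb A"
    using A by (rule nn_integral_cmult_indicator)
  moreover have "emeasure Leb A \<noteq> 0"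
  proof
    assume "emeasure Leb A = 0"
    with A have "A \<in> null_sets Leb" by auto
    then have "negligible A"
      by (auto simp: null_sets_restrict_space negligible_iff_null_sets intro: null_sets_completionI)
    with X(4) show False by (simp add: A_def)
  qed
  ultimately show ?thesis
    by (simp add: ennreal_top_mult top_unique)
qed

text \<open>The substitution \<open>y = f x\<close> absorbs the factor \<open>\<rho>\<close>, and
  the derivative is the reciprocal of \<open>\<rho> (f x)\<close>, so positive and negative parts
  trade places. The two parts are treated separately as nonnegative integrals, so either may be
  infinite.\<close>

lemma Ent_distr_absolutely_continuous:
  fixes f :: "real \<Rightarrow> real"
  assumes f01: "f \<in> {0..1} \<rightarrow> {0..1}" and mono: "mono_on {0..1} f"
    and ac: "absolutely_continuous Leb (distr Leb Leb f)"
  shows "Ent (distr Leb Leb f) Leb =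
    enn2ereal (\<integral>\<^sup>+x. e2ennreal (max 0 (- elog (ereal (deriv f x)))) \<partial>Leb) -
    enn2ereal (\<integral>\<^sup>+x. e2ennreal (max 0 (elog (ereal (deriv f x)))) \<partial>Leb)"
proof -
  interpret Leb: finite_measure Leb
    by (rule finite_measure_Leb)
  have f[measurable]: "f \<in> measurable Leb Leb"
    by (rule measurable_mono_Leb[OF f01 mono])
  interpret \<mu>: finite_measure "distr Leb Leb f"
    by (rule Leb.finite_measure_distr[OF f])
  define \<rho> where "\<rho> = RN_deriv Leb (distr Leb Leb f)"
  have [measurable]: "\<rho> \<in> borel_measurable Leb"
    unfolding \<rho>_def by (rule borel_measurable_RN_deriv)
  have dens: "density Leb \<rho> = distr Leb Leb f"
    unfolding \<rho>_def by (rule Leb.density_RN_deriv[OF ac]) simp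
  have fin: "AE y in Leb. \<rho> y \<noteq> \<infinity>"
    unfolding \<rho>_def by (rule Leb.RN_deriv_finite[OF _ ac]) (simp_all add: \<mu>.sigma_finite_measure_axioms)
  have AE: "AE x in Leb. 0 < enn2real (\<rho> (f x)) \<and> \<rho> (f x) \<noteq> \<infinity> \<and>
           (f has_real_derivative inverse (enn2real (\<rho> (f x)))) (at x)"
    unfolding \<rho>_def by (rule AE_derivative_eq_inverse_density[OF f01 mono ac])
  have subst: "(\<integral>\<^sup>+y. \<rho> y * g (\<rho> y) \<partial>Leb) = (\<integral>\<^sup>+x. g (\<rho> (f x)) \<partial>Leb)"
    if [measurable]: "g \<in> borel_measurable borel" for g
  proof -
    have "(\<integral>\<^sup>+y. \<rho> y * g (\<rho> y) \<partial>Leb) = (\<integral>\<^sup>+y. g (\<rho> y) \<partial>density Leb \<rho>)"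
      by (rule nn_integral_density[symmetric]) measurable
    also have "\<dots> = (\<integral>\<^sup>+x. g (\<rho> (f x)) \<partial>Leb)"
      unfolding dens by (rule nn_integral_distr) measurable
    finally show ?thesis .
  qed
  have log_deriv: "AE x in Leb. elog (ereal (deriv f x)) = - elog (enn2ereal (\<rho> (f x)))"
    using AE
  proof eventually_elim
    case (elim x)
    then have "deriv f x = inverse (enn2real (\<rho> (f x)))"
      by (intro DERIV_imp_deriv) simp
    moreover have "enn2ereal (\<rho> (f x)) = ereal (enn2real (\<rho> (f x)))"
      using elim by (cases "\<rho> (f x)") auto
    ultimately show ?case
      using elim elog_inverse by simp
  qed
  have \<rho>_real: "AE y in Leb. 0 \<le> enn2real (\<rho> y) \<and> \<rho> y = ennreal (enn2real (\<rho> y)) \<and>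
      enn2ereal (\<rho> y) = ereal (enn2real (\<rho> y))"
    using fin
  proof eventually_elim
    case (elim y)
    then show ?case by (cases "\<rho> y") auto
  qed
  have "(\<integral>\<^sup>+y. e2ennreal (max 0 (enn2ereal (\<rho> y) * elog (enn2ereal (\<rho> y)))) \<partial>Leb)
      = (\<integral>\<^sup>+y. \<rho> y * e2ennreal (max 0 (elog (enn2ereal (\<rho> y)))) \<partial>Leb)"
    using \<rho>_real by (intro nn_integral_cong_AE, eventually_elim) (metis e2ennreal_mult_elog(1))
  also have "\<dots> = (\<integral>\<^sup>+x. e2ennreal (max 0 (elog (enn2ereal (\<rho> (f x))))) \<partial>Leb)"
    by (rule subst) measurable
  also have "\<dots> = (\<integral>\<^sup>+x. e2ennreal (max 0 (- elog (ereal (deriv f x)))) \<partial>Leb)"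
    using log_deriv by (intro nn_integral_cong_AE, eventually_elim) simp
  finally have 1: "(\<integral>\<^sup>+y. e2ennreal (max 0 (enn2ereal (\<rho> y) * elog (enn2ereal (\<rho> y)))) \<partial>Leb)
      = (\<integral>\<^sup>+x. e2ennreal (max 0 (- elog (ereal (deriv f x)))) \<partial>Leb)" .
  have "(\<integral>\<^sup>+y. e2ennreal (max 0 (- (enn2ereal (\<rho> y) * elog (enn2ereal (\<rho> y))))) \<partial>Leb)
      = (\<integral>\<^sup>+y. \<rho> y * e2ennreal (max 0 (- elog (enn2ereal (\<rho> y)))) \<partial>Leb)"
    using \<rho>_real by (intro nn_integral_cong_AE, eventually_elim) (metis e2ennreal_mult_elog(2))
  also have "\<dots> = (\<integral>\<^sup>+x. e2ennreal (max 0 (- elog (enn2ereal (\<rho> (f x))))) \<partial>Leb)"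
    by (rule subst) measurable
  also have "\<dots> = (\<integral>\<^sup>+x. e2ennreal (max 0 (elog (ereal (deriv f x)))) \<partial>Leb)"
    using log_deriv by (intro nn_integral_cong_AE, eventually_elim) simp
  finally have 2: "(\<integral>\<^sup>+y. e2ennreal (max 0 (- (enn2ereal (\<rho> y) * elog (enn2ereal (\<rho> y))))) \<partial>Leb)
      = (\<integral>\<^sup>+x. e2ennreal (max 0 (elog (ereal (deriv f x)))) \<partial>Leb)" .
  show ?thesis
    unfolding Ent_def ext_integral_def \<rho>_def[symmetric] 1 2 using ac by simp
qed

theorem proposition6p3:
  fixes f :: "real \<Rightarrow> real"
  assumes "f \<in> G0"
  shows "Ent (Psi f) Leb = - ext_integral Leb (\<lambda>x. elog (ereal (deriv f x)))"
proof -
  have f01: "f \<in> {0..1} \<rightarrow> {0..1}" and mono: "mono_on {0..1} f"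
    using assms by (auto simp: G0_def)
  define P where "P = (\<integral>\<^sup>+x. e2ennreal (max 0 (elog (ereal (deriv f x)))) \<partial>Leb)"
  define N where "N = (\<integral>\<^sup>+x. e2ennreal (max 0 (- elog (ereal (deriv f x)))) \<partial>Leb)"
  \<comment> \<open>With \<open>P\<close> finite, negating \<open>P - N\<close> gives
    \<open>N - P\<close> in \<open>ereal\<close>; the sign change would fail for
    \<open>\<infinity> - \<infinity>\<close>. It also makes the difference
    \<open>\<infinity>\<close> in the singular case, where \<open>N\<close> is infinite.\<close>
  have "P < \<infinity>"
    unfolding P_def by (rule nn_integral_elog_deriv_finite[OF f01 mono])
  then have rhs: "- ext_integral Leb (\<lambda>x. elog (ereal (deriv f x))) = enn2ereal N - enn2ereal P"
    unfolding ext_integral_def P_def[symmetric] N_def[symmetric] by (cases P; cases N) auto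
  show ?thesis
  proof (cases "absolutely_continuous Leb (distr Leb Leb f)")
    case True
    then show ?thesis
      unfolding rhs unfolding Psi_def P_def N_def by (rule Ent_distr_absolutely_continuous[OF f01 mono])
  next
    case False
    then have "N = \<infinity>"
      unfolding N_def by (rule nn_integral_neg_elog_deriv_singular[OF f01 mono])
    with \<open>P < \<infinity>\<close> have "enn2ereal N - enn2ereal P = \<infinity>"
      by (cases P) auto
    with False show ?thesis
      unfolding rhs by (simp add: Ent_def Psi_def)
  qed
qed

end
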